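(* For every $k\in\mathbb{N}\cup\{\infty\}$, $(\mathsf{DMTS},\chi,\le_k)$ is a specification theory for $\mathsf{LTS}$ adequate for $\sim_k$, and $(\mathsf{DMTS},\chi,\le_k^{\mathrm r})$ is a specification theory for $\mathsf{LTS}$ adequate for $\sim_k^{\mathrm r}$.
   Context: Fix a finite alphabet $\Sigma$. An LTS is $(S,s^0,T)$ with $S$ finite, $s^0\in S$, $T\subseteq S\times\Sigma\times S$; $\mathsf{LTS}$ is the set of all LTS. A DMTS is $D=(S,S^0,\dashrightarrow,\longrightarrow)$ with $S$ finite, $S^0\subseteq S$, $\dashrightarrow\subseteq S\times\Sigma\times S$ (written $s\overset{a}{\dashrightarrow}t$), $\longrightarrow\subseteq S\times2^{\Sigma\times S}$ (written $s\longrightarrow N$), such that $s\longrightarrow N$, $(a,t)\in N$ imply $s\overset{a}{\dashrightarrow}t$; $\mathsf{DMTS}$ is the set of all DMTS. For $I=(S,s^0,T)$, $\chi(I)=(S,\{s^0\},T,\{(s,\{(a,t)\})\mid(s,a,t)\in T\})$. Below, indices $j$ range over $\{0,\dots,k\}$ (over $\mathbb{N}$ when $k=\infty$, in which case "$j<k$" always holds and there is no last relation, so the "ready" extra conditions are vacuous). LTS: for $I_i=(S_i,s^0_i,T_i)$, a branching $k$-switching relation family from $I_1$ to $I_2$ is $R^0,\dots,R^k\subseteq S_1\times S_2$ with $(s^0_1,s^0_2)\in R^0$ and: for even $j$ and $(s_1,s_2)\in R^j$: every $(s_1,a,t_1)\in T_1$ has $(s_2,a,t_2)\in T_2$ with $(t_1,t_2)\in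 R^j$, and if $j<k$, every $(s_2,a,t_2)\in T_2$ has $(s_1,a,t_1)\in T_1$ with $(t_1,t_2)\in R^{j+1}$; for odd $j$ and $(s_1,s_2)\in R^j$: every $(s_2,a,t_2)\in T_2$ has $(s_1,a,t_1)\in T_1$ with $(t_1,t_2)\in R^j$, and if $j<k$, every $(s_1,a,t_1)\in T_1$ has $(s_2,a,t_2)\in T_2$ with $(t_1,t_2)\in R^{j+1}$. A branching $k$-ready relation family additionally satisfies for all $(s_1,s_2)\in R^k$: if $k$ is even, for every $(s_2,a,t_2)\in T_2$ there is some $(s_1,a,t_1)\in T_1$; if $k$ is odd, for every $(s_1,a,t_1)\in T_1$ there is some $(s_2,a,t_2)\in T_2$. $I_1\sim_kI_2$ iff there are branching $k$-switching relation families from $I_1$ to $I_2$ and from $I_2$ to $I_1$; $\sim_k^{\mathrm r}$ likewise with $k$-ready families. DMTS: for $D_i=(S_i,S^0_i,\dashrightarrow_i,\longrightarrow_i)$ and $R\subseteq S_1\times S_2$, say $(s_1,s_2)$ satisfies MAY$(R)$ if for every $s_1\overset{a}{\dashrightarrow}_1t_1$ there is $s_2\overset{a}{\dashrightarrow}_2t_2$ with $(t_1,t_2)\in R$, and MUST$(R)$ if for every $s_2\longrightarrow_2N_2$ there is $s_1\longrightarrow_1N_1$ such that for every $(a,t_1)\in N_1$ there is $(a,t_2)\in N_2$ with $(t_1,t_2)\in R$. A branching $k$-switching relation family from $D_1$ to $D_2$ is $R_1^0,\dots,R_1^k,R_2^0,\dots,R_2^k\subseteq S_1\times S_2$ with: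 every $s^0_1\in S^0_1$ has $s^0_2\in S^0_2$ with $(s^0_1,s^0_2)\in R_1^0$, every $s^0_2\in S^0_2$ has $s^0_1\in S^0_1$ with $(s^0_1,s^0_2)\in R_2^0$; for even $j$, every pair in $R_1^j$ satisfies MAY$(R_1^j)$ and, if $j<k$, MUST$(R_1^{j+1})$; for odd $j$, every pair in $R_1^j$ satisfies MUST$(R_1^j)$ and, if $j<k$, MAY$(R_1^{j+1})$; for even $j$, every pair in $R_2^j$ satisfies MUST$(R_2^j)$ and, if $j<k$, MAY$(R_2^{j+1})$; for odd $j$, every pair in $R_2^j$ satisfies MAY$(R_2^j)$ and, if $j<k$, MUST$(R_2^{j+1})$. A branching $k$-ready relation family additionally satisfies: if $k$ is even, every $(s_1,s_2)\in R_1^k$ satisfies "for every $s_2\longrightarrow_2N_2$ there is $s_1\longrightarrow_1N_1$ such that for every $(a,t_1)\in N_1$ there is some $(a,t_2)\in N_2$" and every $(s_1,s_2)\in R_2^k$ satisfies "for every $s_1\overset{a}{\dashrightarrow}_1t_1$ there is some $s_2\overset{a}{\dashrightarrow}_2t_2$"; if $k$ is odd, the same two conditions with the roles of $R_1^k$ and $R_2^k$ exchanged. $D_1\le_kD_2$ iff there is a branching $k$-switching relation family from $D_1$ to $D_2$; $D_1\le_k^{\mathrm r}D_2$ iff there is a branching $k$-ready one. A specification theory for a set $\mathsf{Proc}$ is a triple $(\mathsf{Spec},\chi,\le)$, $\chi:\mathsf{Proc}\to\mathsf{Spec}$, $\le$ a preorder on $\mathsf{Spec}$, such that with $I\models S$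 iff $\chi(I)\le S$, for each $I$: $I\models\chi(I)$ and every $I'\models\chi(I)$ has $\mathrm{Th}(I')=\mathrm{Th}(I)$, where $\mathrm{Th}(I)=\{S\mid I\models S\}$. It is adequate for an equivalence $\sim$ on $\mathsf{Proc}$ if $\mathrm{Th}(I_1)=\mathrm{Th}(I_2)\iff I_1\sim I_2$. *)

theory Defs
  imports Main "HOL-Library.Extended_Nat"
begin

section \<open>Labelled transition systems and disjunctive modal transition systems\<close>

record ('a, 's) lts =
  lstates :: "'s set"
  linit :: "'s"
  ltrans :: "('s \<times> 'a \<times> 's) set"

record ('a, 's) dmts =
  dstates :: "'s set"
  dinit :: "'s set"
  may :: "('s \<times> 'a \<times> 's) set"
  must :: "('s \<times> ('a \<times> 's) set) set"

text \<open>
  State sets are finite subsets of a type \<open>'s\<close>; for infinite \<open>'s\<close> the sets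
  below contain every finite system up to isomorphism.
\<close>

definition LTS :: "'a set \<Rightarrow> ('a, 's) lts set" where
  "LTS \<Sigma> = {I. finite (lstates I) \<and> linit I \<in> lstates I \<and>
      ltrans I \<subseteq> lstates I \<times> \<Sigma> \<times> lstates I}"

definition DMTS :: "'a set \<Rightarrow> ('a, 's) dmts set" where
  "DMTS \<Sigma> = {D. finite (dstates D) \<and> dinit D \<subseteq> dstates D \<and>
      may D \<subseteq> dstates D \<times> \<Sigma> \<times> dstates D \<and>
      must D \<subseteq> dstates D \<times> Pow (\<Sigma> \<times> dstates D) \<and>
      (\<forall>s N a t. (s, N) \<in> must D \<and> (a, t) \<in> N \<longrightarrow> (s, a, t) \<in> may D)}"

definition chi :: "('a, 's) lts \<Rightarrow> ('a, 's) dmts" where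
  "chi I = \<lparr>dstates = lstates I, dinit = {linit I}, may = ltrans I,
      must = {(s, {(a, t)}) | s a t. (s, a, t) \<in> ltrans I}\<rparr>"


section \<open>Branching switching and ready equivalences of LTS\<close>

text \<open>
  A relation family is a function on \<open>nat\<close> of which only the values at
  indices \<open>j\<close> with \<open>enat j \<le> k\<close> matter.
\<close>

definition lts_switching_family ::
  "enat \<Rightarrow> ('a, 's) lts \<Rightarrow> ('a, 't) lts \<Rightarrow> (nat \<Rightarrow> ('s \<times> 't) set) \<Rightarrow> bool" where
  "lts_switching_family k I1 I2 R \<longleftrightarrow>
    (\<forall>j. enat j \<le> k \<longrightarrow> R j \<subseteq> lstates I1 \<times> lstates I2) \<and>
    (linit I1, linit I2) \<in> R 0 \<and>
    (\<forall>j s1 s2. enat j \<le> k \<and> even j \<and> (s1, s2) \<in> R j \<longrightarrow>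
      (\<forall>a t1. (s1, a, t1) \<in> ltrans I1 \<longrightarrow>
        (\<exists>t2. (s2, a, t2) \<in> ltrans I2 \<and> (t1, t2) \<in> R j)) \<and>
      (enat j < k \<longrightarrow>
        (\<forall>a t2. (s2, a, t2) \<in> ltrans I2 \<longrightarrow>
          (\<exists>t1. (s1, a, t1) \<in> ltrans I1 \<and> (t1, t2) \<in> R (Suc j))))) \<and>
    (\<forall>j s1 s2. enat j \<le> k \<and> odd j \<and> (s1, s2) \<in> R j \<longrightarrow>
      (\<forall>a t2. (s2, a, t2) \<in> ltrans I2 \<longrightarrow>
        (\<exists>t1. (s1, a, t1) \<in> ltrans I1 \<and> (t1, t2) \<in> R j)) \<and>
      (enat j < k \<longrightarrow>
        (\<forall>a t1. (s1, a, t1) \<in> ltrans I1 \<longrightarrow>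
          (\<exists>t2. (s2, a, t2) \<in> ltrans I2 \<and> (t1, t2) \<in> R (Suc j)))))"

definition lts_ready_family ::
  "enat \<Rightarrow> ('a, 's) lts \<Rightarrow> ('a, 't) lts \<Rightarrow> (nat \<Rightarrow> ('s \<times> 't) set) \<Rightarrow> bool" where
  "lts_ready_family k I1 I2 R \<longleftrightarrow>
    lts_switching_family k I1 I2 R \<and>
    (\<forall>n. k = enat n \<longrightarrow> (\<forall>(s1, s2) \<in> R n.
      (even n \<longrightarrow> (\<forall>a t2. (s2, a, t2) \<in> ltrans I2 \<longrightarrow> (\<exists>t1. (s1, a, t1) \<in> ltrans I1))) \<and>
      (odd n \<longrightarrow> (\<forall>a t1. (s1, a, t1) \<in> ltrans I1 \<longrightarrow> (\<exists>t2. (s2, a, t2) \<in> ltrans I2)))))"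

definition lts_switching_equiv :: "enat \<Rightarrow> ('a, 's) lts \<Rightarrow> ('a, 't) lts \<Rightarrow> bool" where
  "lts_switching_equiv k I1 I2 \<longleftrightarrow>
    (\<exists>R. lts_switching_family k I1 I2 R) \<and> (\<exists>R. lts_switching_family k I2 I1 R)"

definition lts_ready_equiv :: "enat \<Rightarrow> ('a, 's) lts \<Rightarrow> ('a, 't) lts \<Rightarrow> bool" where
  "lts_ready_equiv k I1 I2 \<longleftrightarrow>
    (\<exists>R. lts_ready_family k I1 I2 R) \<and> (\<exists>R. lts_ready_family k I2 I1 R)"


section \<open>Branching switching and ready refinements of DMTS\<close>

definition may_cond ::
  "('a, 's) dmts \<Rightarrow> ('a, 't) dmts \<Rightarrow> ('s \<times> 't) set \<Rightarrow> 's \<Rightarrow> 't \<Rightarrow> bool" where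
  "may_cond D1 D2 R s1 s2 \<longleftrightarrow>
    (\<forall>a t1. (s1, a, t1) \<in> may D1 \<longrightarrow> (\<exists>t2. (s2, a, t2) \<in> may D2 \<and> (t1, t2) \<in> R))"

definition must_cond ::
  "('a, 's) dmts \<Rightarrow> ('a, 't) dmts \<Rightarrow> ('s \<times> 't) set \<Rightarrow> 's \<Rightarrow> 't \<Rightarrow> bool" where
  "must_cond D1 D2 R s1 s2 \<longleftrightarrow>
    (\<forall>N2. (s2, N2) \<in> must D2 \<longrightarrow>
      (\<exists>N1. (s1, N1) \<in> must D1 \<and>
        (\<forall>a t1. (a, t1) \<in> N1 \<longrightarrow> (\<exists>t2. (a, t2) \<in> N2 \<and> (t1, t2) \<in> R))))"

definition dmts_switching_family ::
  "enat \<Rightarrow> ('a, 's) dmts \<Rightarrow> ('a, 't) dmts \<Rightarrow>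
    (nat \<Rightarrow> ('s \<times> 't) set) \<Rightarrow> (nat \<Rightarrow> ('s \<times> 't) set) \<Rightarrow> bool" where
  "dmts_switching_family k D1 D2 R1 R2 \<longleftrightarrow>
    (\<forall>j. enat j \<le> k \<longrightarrow>
      R1 j \<subseteq> dstates D1 \<times> dstates D2 \<and> R2 j \<subseteq> dstates D1 \<times> dstates D2) \<and>
    (\<forall>s1 \<in> dinit D1. \<exists>s2 \<in> dinit D2. (s1, s2) \<in> R1 0) \<and>
    (\<forall>s2 \<in> dinit D2. \<exists>s1 \<in> dinit D1. (s1, s2) \<in> R2 0) \<and>
    (\<forall>j s1 s2. enat j \<le> k \<and> even j \<and> (s1, s2) \<in> R1 j \<longrightarrow>
      may_cond D1 D2 (R1 j) s1 s2 \<and>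
      (enat j < k \<longrightarrow> must_cond D1 D2 (R1 (Suc j)) s1 s2)) \<and>
    (\<forall>j s1 s2. enat j \<le> k \<and> odd j \<and> (s1, s2) \<in> R1 j \<longrightarrow>
      must_cond D1 D2 (R1 j) s1 s2 \<and>
      (enat j < k \<longrightarrow> may_cond D1 D2 (R1 (Suc j)) s1 s2)) \<and>
    (\<forall>j s1 s2. enat j \<le> k \<and> even j \<and> (s1, s2) \<in> R2 j \<longrightarrow>
      must_cond D1 D2 (R2 j) s1 s2 \<and>
      (enat j < k \<longrightarrow> may_cond D1 D2 (R2 (Suc j)) s1 s2)) \<and>
    (\<forall>j s1 s2. enat j \<le> k \<and> odd j \<and> (s1, s2) \<in> R2 j \<longrightarrow>
      may_cond D1 D2 (R2 j) s1 s2 \<and>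
      (enat j < k \<longrightarrow> must_cond D1 D2 (R2 (Suc j)) s1 s2))"

definition may_ready_cond ::
  "('a, 's) dmts \<Rightarrow> ('a, 't) dmts \<Rightarrow> 's \<Rightarrow> 't \<Rightarrow> bool" where
  "may_ready_cond D1 D2 s1 s2 \<longleftrightarrow>
    (\<forall>a t1. (s1, a, t1) \<in> may D1 \<longrightarrow> (\<exists>t2. (s2, a, t2) \<in> may D2))"

definition must_ready_cond ::
  "('a, 's) dmts \<Rightarrow> ('a, 't) dmts \<Rightarrow> 's \<Rightarrow> 't \<Rightarrow> bool" where
  "must_ready_cond D1 D2 s1 s2 \<longleftrightarrow>
    (\<forall>N2. (s2, N2) \<in> must D2 \<longrightarrow>
      (\<exists>N1. (s1, N1) \<in> must D1 \<and>
        (\<forall>a t1. (a, t1) \<in> N1 \<longrightarrow> (\<exists>t2. (a, t2) \<in> N2))))"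

definition dmts_ready_family ::
  "enat \<Rightarrow> ('a, 's) dmts \<Rightarrow> ('a, 't) dmts \<Rightarrow>
    (nat \<Rightarrow> ('s \<times> 't) set) \<Rightarrow> (nat \<Rightarrow> ('s \<times> 't) set) \<Rightarrow> bool" where
  "dmts_ready_family k D1 D2 R1 R2 \<longleftrightarrow>
    dmts_switching_family k D1 D2 R1 R2 \<and>
    (\<forall>n. k = enat n \<longrightarrow>
      (even n \<longrightarrow>
        (\<forall>(s1, s2) \<in> R1 n. must_ready_cond D1 D2 s1 s2) \<and>
        (\<forall>(s1, s2) \<in> R2 n. may_ready_cond D1 D2 s1 s2)) \<and>
      (odd n \<longrightarrow>
        (\<forall>(s1, s2) \<in> R2 n. must_ready_cond D1 D2 s1 s2) \<and>
        (\<forall>(s1, s2) \<in> R1 n. may_ready_cond D1 D2 s1 s2)))"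

definition dmts_switching_le :: "enat \<Rightarrow> ('a, 's) dmts \<Rightarrow> ('a, 't) dmts \<Rightarrow> bool" where
  "dmts_switching_le k D1 D2 \<longleftrightarrow> (\<exists>R1 R2. dmts_switching_family k D1 D2 R1 R2)"

definition dmts_ready_le :: "enat \<Rightarrow> ('a, 's) dmts \<Rightarrow> ('a, 't) dmts \<Rightarrow> bool" where
  "dmts_ready_le k D1 D2 \<longleftrightarrow> (\<exists>R1 R2. dmts_ready_family k D1 D2 R1 R2)"


section \<open>Specification theories\<close>

definition models :: "('p \<Rightarrow> 'd) \<Rightarrow> ('d \<Rightarrow> 'd \<Rightarrow> bool) \<Rightarrow> 'p \<Rightarrow> 'd \<Rightarrow> bool" where
  "models \<chi> le I S \<longleftrightarrow> le (\<chi> I) S"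

definition Th :: "'d set \<Rightarrow> ('p \<Rightarrow> 'd) \<Rightarrow> ('d \<Rightarrow> 'd \<Rightarrow> bool) \<Rightarrow> 'p \<Rightarrow> 'd set" where
  "Th Spec \<chi> le I = {S \<in> Spec. models \<chi> le I S}"

definition specification_theory ::
  "'p set \<Rightarrow> 'd set \<Rightarrow> ('p \<Rightarrow> 'd) \<Rightarrow> ('d \<Rightarrow> 'd \<Rightarrow> bool) \<Rightarrow> bool" where
  "specification_theory Proc Spec \<chi> le \<longleftrightarrow>
    \<chi> ` Proc \<subseteq> Spec \<and>
    reflp_on Spec le \<and> transp_on Spec le \<and>
    (\<forall>I \<in> Proc. models \<chi> le I (\<chi> I) \<and>
      (\<forall>I' \<in> Proc. models \<chi> le I' (\<chi> I) \<longrightarrow> Th Spec \<chi> le I' = Th Spec \<chi> le I))"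

definition adequate_for ::
  "'p set \<Rightarrow> 'd set \<Rightarrow> ('p \<Rightarrow> 'd) \<Rightarrow> ('d \<Rightarrow> 'd \<Rightarrow> bool) \<Rightarrow> ('p \<Rightarrow> 'p \<Rightarrow> bool) \<Rightarrow> bool" where
  "adequate_for Proc Spec \<chi> le eqv \<longleftrightarrow>
    reflp_on Proc eqv \<and> symp_on Proc eqv \<and> transp_on Proc eqv \<and>
    (\<forall>I1 \<in> Proc. \<forall>I2 \<in> Proc. Th Spec \<chi> le I1 = Th Spec \<chi> le I2 \<longleftrightarrow> eqv I1 I2)"

end

theory Submission
  imports Defs
begin

text \<open>
  Both refinements are preorders, as relation families compose pointwise. On images of \<open>chi\<close>,
  \<open>MAY(R)\<close> and \<open>MUST(R)\<close> become the two halves of the bisimulation condition, so the first family of a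
  refinement from \<open>chi I1\<close> to \<open>chi I2\<close> is an LTS family from \<open>I1\<close> to \<open>I2\<close>, and the converse of the
  second one is an LTS family from \<open>I2\<close> to \<open>I1\<close>. Hence \<open>chi I1 \<le> chi I2\<close> holds exactly if
  \<open>I1\<close> and \<open>I2\<close> are equivalent, which is symmetric; the rest holds for any preorder.
\<close>

text \<open>By \<open>eqv\<close> and \<open>sym\<close>, \<open>le\<close> is symmetric on images
  of \<open>\<chi>\<close>, so transitivity carries every specification in \<open>Th\<close> between
  equivalent processes in both directions. Conversely, \<open>\<chi> I2\<close> is a characteristic
  specification: it lies in the theory of \<open>I2\<close>, so equality of theories yields
  \<open>le (\<chi> I1) (\<chi> I2)\<close>.\<close>

lemma specification_theory_adequate_forI:
  assumes sub: "\<chi> ` Proc \<subseteq> Spec" and refl: "reflp_on Spec le" and trans: "transp_on Spec le"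
    and eqv: "\<And>I1 I2. I1 \<in> Proc \<Longrightarrow> I2 \<in> Proc \<Longrightarrow> le (\<chi> I1) (\<chi> I2) \<longleftrightarrow> eqv I1 I2"
    and sym: "\<And>I1 I2. eqv I1 I2 \<Longrightarrow> eqv I2 I1"
  shows "specification_theory Proc Spec \<chi> le \<and> adequate_for Proc Spec \<chi> le eqv"
proof -
  have in_Spec: "\<chi> I \<in> Spec" if "I \<in> Proc" for I
    using sub that by blast
  have le_refl: "le (\<chi> I) (\<chi> I)" if "I \<in> Proc" for I
    using refl in_Spec[OF that] by (simp add: reflp_on_def)
  have le_trans: "le (\<chi> I1) S" if "I1 \<in> Proc" "I2 \<in> Proc" "S \<in> Spec" "le (\<chi> I1) (\<chi> I2)" "le (\<chi> I2) S"
    for I1 I2 S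
    using transp_onD[OF trans in_Spec[OF that(1)] in_Spec[OF that(2)] that(3-5)] .
  have Th_subset: "Th Spec \<chi> le I2 \<subseteq> Th Spec \<chi> le I1"
    if "I1 \<in> Proc" "I2 \<in> Proc" "eqv I1 I2" for I1 I2
    using that le_trans eqv by (auto simp: Th_def models_def)
  then have Th_eq: "Th Spec \<chi> le I1 = Th Spec \<chi> le I2"
    if "I1 \<in> Proc" "I2 \<in> Proc" "eqv I1 I2" for I1 I2
    using that sym by (simp add: subset_antisym)
  have Th_eq_iff: "Th Spec \<chi> le I1 = Th Spec \<chi> le I2 \<longleftrightarrow> eqv I1 I2"
    if I: "I1 \<in> Proc" "I2 \<in> Proc" for I1 I2
  proof
    assume "Th Spec \<chi> le I1 = Th Spec \<chi> le I2"
    moreover have "\<chi> I2 \<in> Th Spec \<chi> le I2"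
      using I in_Spec le_refl by (simp add: Th_def models_def)
    ultimately show "eqv I1 I2"
      using I eqv by (auto simp: Th_def models_def)
  qed (use I Th_eq in blast)
  have "reflp_on Proc eqv"
    using le_refl eqv by (simp add: reflp_on_def)
  moreover have "symp_on Proc eqv"
    using sym by (simp add: symp_on_def)
  \<comment> \<open>Inherited from \<open>le\<close>, with \<open>\<chi> I3\<close> in the place of
    \<open>S\<close>.\<close>
  moreover have "transp_on Proc eqv"
  proof (rule transp_onI)
    fix I1 I2 I3
    assume I: "I1 \<in> Proc" "I2 \<in> Proc" "I3 \<in> Proc" and "eqv I1 I2" "eqv I2 I3"
    then have "le (\<chi> I1) (\<chi> I3)"
      using le_trans[OF I(1,2) in_Spec[OF I(3)]] eqv by simp
    then show "eqv I1 I3"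
      using eqv I by simp
  qed
  ultimately show ?thesis
    unfolding specification_theory_def adequate_for_def models_def
    using sub refl trans le_refl Th_eq Th_eq_iff eqv by simp
qed

lemma may_cond_relcomp:
  "may_cond D1 D2 R s1 s2 \<Longrightarrow> may_cond D2 D3 Q s2 s3 \<Longrightarrow> may_cond D1 D3 (R O Q) s1 s3"
  unfolding may_cond_def by (meson relcompI)

text \<open>An obligation of \<open>s3\<close> is pulled back to \<open>s2\<close> and then to
  \<open>s1\<close>; the elements of the set found at \<open>s1\<close> are then pushed forward
  through the set at \<open>s2\<close>.\<close>

lemma must_cond_relcomp:
  "must_cond D1 D2 R s1 s2 \<Longrightarrow> must_cond D2 D3 Q s2 s3 \<Longrightarrow> must_cond D1 D3 (R O Q) s1 s3"
  unfolding must_cond_def by (meson relcompI)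

lemma may_ready_cond_trans:
  "may_ready_cond D1 D2 s1 s2 \<Longrightarrow> may_ready_cond D2 D3 s2 s3 \<Longrightarrow> may_ready_cond D1 D3 s1 s3"
  unfolding may_ready_cond_def by meson

lemma must_ready_cond_trans:
  "must_ready_cond D1 D2 s1 s2 \<Longrightarrow> must_ready_cond D2 D3 s2 s3 \<Longrightarrow> must_ready_cond D1 D3 s1 s3"
  unfolding must_ready_cond_def by meson

text \<open>Each transition matches itself; membership in \<open>DMTS\<close> places its target in
  \<open>dstates D\<close>, hence the pair in \<open>Id_on\<close>.\<close>

lemma may_cond_Id_on: "D \<in> DMTS \<Sigma> \<Longrightarrow> may_cond D D (Id_on (dstates D)) s s"
  by (auto simp: may_cond_def DMTS_def)

lemma must_cond_Id_on: "D \<in> DMTS \<Sigma> \<Longrightarrow> must_cond D D (Id_on (dstates D)) s s"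
  by (fastforce simp: must_cond_def DMTS_def)

lemma may_ready_cond_refl: "may_ready_cond D D s s"
  by (auto simp: may_ready_cond_def)

lemma must_ready_cond_refl: "must_ready_cond D D s s"
  by (auto simp: must_ready_cond_def)

text \<open>For a constant family the shift from \<open>j\<close> to \<open>Suc j\<close> is
  invisible, so all four parity clauses follow from the same two facts on the diagonal.\<close>

lemma dmts_switching_family_Id_on:
  assumes "D \<in> DMTS \<Sigma>"
  shows "dmts_switching_family k D D (\<lambda>_. Id_on (dstates D)) (\<lambda>_. Id_on (dstates D))"
proof -
  have "dinit D \<subseteq> dstates D"
    using assms by (simp add: DMTS_def)
  then show ?thesis
    using may_cond_Id_on[OF assms] must_cond_Id_on[OF assms]
    by (force simp: dmts_switching_family_def Id_on_iff)
qed

lemma dmts_ready_family_Id_on: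
  assumes "D \<in> DMTS \<Sigma>"
  shows "dmts_ready_family k D D (\<lambda>_. Id_on (dstates D)) (\<lambda>_. Id_on (dstates D))"
  using dmts_switching_family_Id_on[OF assms]
  by (auto simp: dmts_ready_family_def may_ready_cond_refl must_ready_cond_refl)

text \<open>The common shape of the four parity clauses: \<open>p\<close> is the parity,
  \<open>A\<close> the condition for staying at index \<open>j\<close>, \<open>B\<close> the one for
  switching to \<open>Suc j\<close>.\<close>

lemma step_cond_relcomp:
  assumes "\<forall>j s1 s2. enat j \<le> k \<and> p j \<and> (s1, s2) \<in> R j \<longrightarrow>
      A12 (R j) s1 s2 \<and> (enat j < k \<longrightarrow> B12 (R (Suc j)) s1 s2)"
    and "\<forall>j s2 s3. enat j \<le> k \<and> p j \<and> (s2, s3) \<in> Q j \<longrightarrow>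
      A23 (Q j) s2 s3 \<and> (enat j < k \<longrightarrow> B23 (Q (Suc j)) s2 s3)"
    and "\<And>X Y s1 s2 s3. A12 X s1 s2 \<Longrightarrow> A23 Y s2 s3 \<Longrightarrow> A13 (X O Y) s1 s3"
    and "\<And>X Y s1 s2 s3. B12 X s1 s2 \<Longrightarrow> B23 Y s2 s3 \<Longrightarrow> B13 (X O Y) s1 s3"
  shows "\<forall>j s1 s3. enat j \<le> k \<and> p j \<and> (s1, s3) \<in> R j O Q j \<longrightarrow>
      A13 (R j O Q j) s1 s3 \<and> (enat j < k \<longrightarrow> B13 (R (Suc j) O Q (Suc j)) s1 s3)"
proof (intro allI impI)
  fix j s1 s3
  assume *: "enat j \<le> k \<and> p j \<and> (s1, s3) \<in> R j O Q j"
  then obtain s2 where "(s1, s2) \<in> R j" "(s2, s3) \<in> Q j"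
    by blast
  with * assms(1,2) have "A12 (R j) s1 s2 \<and> (enat j < k \<longrightarrow> B12 (R (Suc j)) s1 s2)"
    "A23 (Q j) s2 s3 \<and> (enat j < k \<longrightarrow> B23 (Q (Suc j)) s2 s3)"
    by blast+
  then show "A13 (R j O Q j) s1 s3 \<and> (enat j < k \<longrightarrow> B13 (R (Suc j) O Q (Suc j)) s1 s3)"
    using assms(3,4) by blast
qed

lemma dmts_switching_family_relcomp:
  assumes "dmts_switching_family k D1 D2 R1 R2" "dmts_switching_family k D2 D3 Q1 Q2"
  shows "dmts_switching_family k D1 D3 (\<lambda>j. R1 j O Q1 j) (\<lambda>j. R2 j O Q2 j)"
proof -
  \<comment> \<open>The first instance serves even indices of \<open>R1\<close> and odd ones of
    \<open>R2\<close>, the second the opposite parities. Fixing \<open>A\<close> and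
    \<open>B\<close> avoids ambiguous higher-order unification.\<close>
  note may_must = step_cond_relcomp[where ?A12.0 = "may_cond D1 D2" and ?A23.0 = "may_cond D2 D3"
      and ?A13.0 = "may_cond D1 D3" and ?B12.0 = "must_cond D1 D2" and ?B23.0 = "must_cond D2 D3"
      and ?B13.0 = "must_cond D1 D3"]
  note must_may = step_cond_relcomp[where ?A12.0 = "must_cond D1 D2" and ?A23.0 = "must_cond D2 D3"
      and ?A13.0 = "must_cond D1 D3" and ?B12.0 = "may_cond D1 D2" and ?B23.0 = "may_cond D2 D3"
      and ?B13.0 = "may_cond D1 D3"]
  have sub: "\<forall>j. enat j \<le> k \<longrightarrow> A j O C j \<subseteq> X \<times> Z \<and> B j O D j \<subseteq> X \<times> Z"
    if "\<forall>j. enat j \<le> k \<longrightarrow> A j \<subseteq> X \<times> Y \<and> B j \<subseteq> X \<times> Y" "\<forall>j. enat j \<le> k \<longrightarrow> C j \<subseteq> Y \<times> Z \<and> D j \<subseteq> Y \<times> Z"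
    for A B :: "nat \<Rightarrow> ('b \<times> 'c) set" and C D :: "nat \<Rightarrow> ('c \<times> 'd) set" and X Y Z
    using that by blast
  have init1: "\<forall>s1 \<in> X. \<exists>s3 \<in> Z. (s1, s3) \<in> A O B"
    if "\<forall>s1 \<in> X. \<exists>s2 \<in> Y. (s1, s2) \<in> A" "\<forall>s2 \<in> Y. \<exists>s3 \<in> Z. (s2, s3) \<in> B"
    for X Y Z and A :: "('b \<times> 'c) set" and B :: "('c \<times> 'd) set"
    using that by (meson relcompI)
  have init2: "\<forall>s3 \<in> Z. \<exists>s1 \<in> X. (s1, s3) \<in> A O B"
    if "\<forall>s2 \<in> Y. \<exists>s1 \<in> X. (s1, s2) \<in> A" "\<forall>s3 \<in> Z. \<exists>s2 \<in> Y. (s2, s3) \<in> B"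
    for X Y Z and A :: "('b \<times> 'c) set" and B :: "('c \<times> 'd) set"
    using that by (meson relcompI)
  \<comment> \<open>Each conjunct of the goal comes from the corresponding conjuncts of the two
    assumptions: \<open>erule (1)\<close> matches the first and finds the second by
    assumption.\<close>
  show ?thesis
    using assms unfolding dmts_switching_family_def
    by (elim conjE, intro conjI)
      (erule (1) sub init1 init2 may_must must_may may_cond_relcomp must_cond_relcomp)+
qed

text \<open>At a finite last index both ready conditions are transitive; for
  \<open>k = \<infinity>\<close> there is no last index.\<close>

lemma dmts_ready_family_relcomp:
  assumes "dmts_ready_family k D1 D2 R1 R2" "dmts_ready_family k D2 D3 Q1 Q2"
  shows "dmts_ready_family k D1 D3 (\<lambda>j. R1 j O Q1 j) (\<lambda>j. R2 j O Q2 j)"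
proof (cases k)
  case (enat n)
  then show ?thesis
    using assms dmts_switching_family_relcomp[of k D1 D2 R1 R2 D3 Q1 Q2]
    by (cases "even n") (simp_all add: dmts_ready_family_def,
      (blast intro: may_ready_cond_trans must_ready_cond_trans)+)
next
  case infinity
  then show ?thesis
    using assms dmts_switching_family_relcomp by (simp add: dmts_ready_family_def)
qed

lemma reflp_on_dmts_switching_le: "reflp_on (DMTS \<Sigma>) (dmts_switching_le k)"
  unfolding reflp_on_def dmts_switching_le_def by (meson dmts_switching_family_Id_on)

lemma reflp_on_dmts_ready_le: "reflp_on (DMTS \<Sigma>) (dmts_ready_le k)"
  unfolding reflp_on_def dmts_ready_le_def by (meson dmts_ready_family_Id_on)

lemma transp_dmts_switching_le: "transp (dmts_switching_le k)"
  unfolding transp_def dmts_switching_le_def by (meson dmts_switching_family_relcomp)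

lemma transp_dmts_ready_le: "transp (dmts_ready_le k)"
  unfolding transp_def dmts_ready_le_def by (meson dmts_ready_family_relcomp)

lemma chi_in_DMTS: "I \<in> LTS \<Sigma> \<Longrightarrow> chi I \<in> DMTS \<Sigma>"
  by (auto simp: LTS_def DMTS_def chi_def)

text \<open>Obligations of \<open>chi I\<close> are singletons, one per transition. This collapses
  the nested quantifiers of MUST and of its ready variant.\<close>

lemma all_must_chi:
  "(\<forall>N. (s, N) \<in> must (chi I) \<longrightarrow> P N) \<longleftrightarrow> (\<forall>a t. (s, a, t) \<in> ltrans I \<longrightarrow> P {(a, t)})"
  by (auto simp: chi_def)

lemma ex_must_chi:
  "(\<exists>N. (s, N) \<in> must (chi I) \<and> P N) \<longleftrightarrow> (\<exists>a t. (s, a, t) \<in> ltrans I \<and> P {(a, t)})"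
  by (auto simp: chi_def)

lemma may_cond_chi:
  "may_cond (chi I1) (chi I2) R s1 s2 \<longleftrightarrow>
    (\<forall>a t1. (s1, a, t1) \<in> ltrans I1 \<longrightarrow> (\<exists>t2. (s2, a, t2) \<in> ltrans I2 \<and> (t1, t2) \<in> R))"
  by (simp add: may_cond_def chi_def)

lemma must_cond_chi:
  "must_cond (chi I1) (chi I2) R s1 s2 \<longleftrightarrow>
    (\<forall>a t2. (s2, a, t2) \<in> ltrans I2 \<longrightarrow> (\<exists>t1. (s1, a, t1) \<in> ltrans I1 \<and> (t1, t2) \<in> R))"
  by (auto simp: must_cond_def all_must_chi ex_must_chi)

lemma may_ready_cond_chi:
  "may_ready_cond (chi I1) (chi I2) s1 s2 \<longleftrightarrow>
    (\<forall>a t1. (s1, a, t1) \<in> ltrans I1 \<longrightarrow> (\<exists>t2. (s2, a, t2) \<in> ltrans I2))"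
  by (simp add: may_ready_cond_def chi_def)

lemma must_ready_cond_chi:
  "must_ready_cond (chi I1) (chi I2) s1 s2 \<longleftrightarrow>
    (\<forall>a t2. (s2, a, t2) \<in> ltrans I2 \<longrightarrow> (\<exists>t1. (s1, a, t1) \<in> ltrans I1))"
  by (auto simp: must_ready_cond_def all_must_chi ex_must_chi)

text \<open>\<open>R2\<close> starts with MUST, which is forward simulation when read from
  \<open>I2\<close> to \<open>I1\<close>; so the converse keeps every index and its parity.\<close>

lemma dmts_switching_family_chi:
  "dmts_switching_family k (chi I1) (chi I2) R1 R2 \<longleftrightarrow>
    lts_switching_family k I1 I2 R1 \<and> lts_switching_family k I2 I1 (\<lambda>j. (R2 j)\<inverse>)"
proof -
  have states: "(\<forall>j. enat j \<le> k \<longrightarrow> R1 j \<subseteq> dstates (chi I1) \<times> dstates (chi I2) \<and>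
        R2 j \<subseteq> dstates (chi I1) \<times> dstates (chi I2)) \<longleftrightarrow>
      (\<forall>j. enat j \<le> k \<longrightarrow> R1 j \<subseteq> lstates I1 \<times> lstates I2) \<and>
      (\<forall>j. enat j \<le> k \<longrightarrow> (R2 j)\<inverse> \<subseteq> lstates I2 \<times> lstates I1)"
  proof -
    have "S\<inverse> \<subseteq> B \<times> A \<longleftrightarrow> S \<subseteq> A \<times> B" for S :: "('b \<times> 'c) set" and A B
      by auto
    then show ?thesis
      by (simp add: chi_def imp_conjR all_conj_distrib)
  qed
  have init: "(\<forall>s1 \<in> dinit (chi I1). \<exists>s2 \<in> dinit (chi I2). (s1, s2) \<in> R) \<longleftrightarrow> (linit I1, linit I2) \<in> R"
    "(\<forall>s2 \<in> dinit (chi I2). \<exists>s1 \<in> dinit (chi I1). (s1, s2) \<in> R) \<longleftrightarrow> (linit I1, linit I2) \<in> R" for R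
    by (simp_all add: chi_def)
  \<comment> \<open>\<open>X\<close> and \<open>Y\<close> stand for the index bound and the parity.
    This reorders the quantifiers so that both sides agree syntactically; it must act before
    \<open>converse_iff\<close>, which would destroy its pattern.\<close>
  have swap: "(\<forall>s2 s1. X \<and> Y \<and> (s2, s1) \<in> R\<inverse> \<longrightarrow> P s2 s1) \<longleftrightarrow> (\<forall>s1 s2. X \<and> Y \<and> (s1, s2) \<in> R \<longrightarrow> P s2 s1)"
    for X Y P and R :: "('b \<times> 'c) set"
    by blast
  show ?thesis
    unfolding dmts_switching_family_def lts_switching_family_def
    by (simp only: states init swap may_cond_chi must_cond_chi, simp only: converse_iff)
      (intro iffI; elim conjE; intro conjI; assumption)
qed

lemma dmts_ready_family_chi:
  "dmts_ready_family k (chi I1) (chi I2) R1 R2 \<longleftrightarrow>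
    lts_ready_family k I1 I2 R1 \<and> lts_ready_family k I2 I1 (\<lambda>j. (R2 j)\<inverse>)"
proof -
  have ball: "(\<forall>(s1, s2) \<in> R. P s1 s2) \<longleftrightarrow> (\<forall>s1 s2. (s1, s2) \<in> R \<longrightarrow> P s1 s2)" for P and R :: "('b \<times> 'c) set"
    by auto
  have ball_converse: "(\<forall>(s2, s1) \<in> R\<inverse>. P s2 s1) \<longleftrightarrow> (\<forall>s1 s2. (s1, s2) \<in> R \<longrightarrow> P s2 s1)"
    for P and R :: "('b \<times> 'c) set"
    by auto
  \<comment> \<open>For \<open>k = \<infinity>\<close> the value \<open>the_enat k\<close> is
    arbitrary, but the ready conditions are vacuous there.\<close>
  show ?thesis
    unfolding dmts_ready_family_def lts_ready_family_def dmts_switching_family_chi ball ball_converse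
      may_ready_cond_chi must_ready_cond_chi
    by (cases k; cases "even (the_enat k)") (simp_all add: conj_ac)
qed

lemma dmts_switching_le_chi:
  "dmts_switching_le k (chi I1) (chi I2) \<longleftrightarrow> lts_switching_equiv k I1 I2"
proof
  assume "lts_switching_equiv k I1 I2"
  then obtain R Q where "lts_switching_family k I1 I2 R" "lts_switching_family k I2 I1 Q"
    by (auto simp: lts_switching_equiv_def)
  then have "dmts_switching_family k (chi I1) (chi I2) R (\<lambda>j. (Q j)\<inverse>)"
    by (simp add: dmts_switching_family_chi)
  then show "dmts_switching_le k (chi I1) (chi I2)"
    by (auto simp: dmts_switching_le_def)
qed (auto simp: dmts_switching_le_def lts_switching_equiv_def dmts_switching_family_chi)

lemma dmts_ready_le_chi:
  "dmts_ready_le k (chi I1) (chi I2) \<longleftrightarrow> lts_ready_equiv k I1 I2"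
proof
  assume "lts_ready_equiv k I1 I2"
  then obtain R Q where "lts_ready_family k I1 I2 R" "lts_ready_family k I2 I1 Q"
    by (auto simp: lts_ready_equiv_def)
  then have "dmts_ready_family k (chi I1) (chi I2) R (\<lambda>j. (Q j)\<inverse>)"
    by (simp add: dmts_ready_family_chi)
  then show "dmts_ready_le k (chi I1) (chi I2)"
    by (auto simp: dmts_ready_le_def)
qed (auto simp: dmts_ready_le_def lts_ready_equiv_def dmts_ready_family_chi)

theorem theorem2:
  fixes \<Sigma> :: "'a set" and k :: enat
  assumes "finite \<Sigma>"
  shows "(specification_theory (LTS \<Sigma> :: ('a, 's) lts set) (DMTS \<Sigma>) chi (dmts_switching_le k) \<and>
          adequate_for (LTS \<Sigma> :: ('a, 's) lts set) (DMTS \<Sigma>) chi (dmts_switching_le k)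
            (lts_switching_equiv k)) \<and>
         (specification_theory (LTS \<Sigma> :: ('a, 's) lts set) (DMTS \<Sigma>) chi (dmts_ready_le k) \<and>
          adequate_for (LTS \<Sigma> :: ('a, 's) lts set) (DMTS \<Sigma>) chi (dmts_ready_le k)
            (lts_ready_equiv k))"
proof (intro conjI[of "_ \<and> _" "_ \<and> _"] specification_theory_adequate_forI)
  \<comment> \<open>The instance of \<open>conjI\<close> splits only the outermost conjunction,
    keeping each pair intact for the criterion. Every premise thus arises once for switching and
    once for ready.\<close>
  show "chi ` LTS \<Sigma> \<subseteq> DMTS \<Sigma>" "chi ` LTS \<Sigma> \<subseteq> DMTS \<Sigma>"
    by (auto intro: chi_in_DMTS)
  show "transp_on (DMTS \<Sigma>) (dmts_switching_le k)" "transp_on (DMTS \<Sigma>) (dmts_ready_le k)"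
    using transp_dmts_switching_le transp_dmts_ready_le by (blast intro: transp_on_subset)+
qed (simp_all add: reflp_on_dmts_switching_le reflp_on_dmts_ready_le dmts_switching_le_chi
    dmts_ready_le_chi lts_switching_equiv_def lts_ready_equiv_def)

end
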